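(* Let $\mathcal{N}$ be the (finite) set of nodes of a network, and for $i\in\mathcal{N}$ let $\mathcal{L}_i(\bm x_i)=u_i(\bm x_i)+\max\{h_i(\bm x_i),0\}$, $\bm x_i\in\mathbb{R}^{2N_i+1}$, be the local Lagrangian of node $i$, where $$u_i(\bm x_i)=(\bm x_i-\bm b_i)^T Q_i(\bm x_i-\bm b_i)+\bm\nu_i^T A_i\bm x_i,\qquad h_i(\bm x_i)=\bm q_i^T\bm x_i-\hat P_i^{H},$$ with all data as in the context. Then the solution $\bm x_i^+=\arg\min_{\bm x_i\in\mathbb{R}^{2N_i+1}}\mathcal{L}_i(\bm x_i)$ of the primal step at node $i$ is given by one of the following mutually exclusive cases: (i) $\bm x_i^+=\arg\min_{\bm x_i}u_i(\bm x_i)$, if this point satisfies $h_i(\bm x_i^+)\le 0$; or (ii) $\bm x_i^+=\arg\min_{\bm x_i}\big(u_i(\bm x_i)+h_i(\bm x_i)\big)$, if this point satisfies $h_i(\bm x_i^+)>0$; or (iii) if neither the condition in (i) nor the condition in (ii) holds, $\bm x_i^+=\arg\min_{\bm x_i}u_i(\bm x_i)$ subject to $h_i(\bm x_i)=0$. (In particular, the conditions in (i) and (ii) cannot both hold.)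
   Context: Each node $i\in\mathcal{N}$ has $N_i\ge 1$ neighbors. Its local variable is $\bm x_i=[\bm o_i,\tilde{\bm o}_i,\hat\delta_i]\in\mathbb{R}^{N_i}\times\mathbb{R}^{N_i}\times\mathbb{R}$ (workload sent to each neighbor, workload received from each neighbor, and a scalar slack variable). The minimizations are unconstrained over $\mathbb{R}^{2N_i+1}$ unless a constraint is written, because all constraints have been dualized. Data at node $i$: - $\bm b_i=[\bar{\bm w}_i,\tilde{\bm w}_i,0]\in\mathbb{R}^{2N_i+1}$ is a given vector, with $\bar{\bm w}_i,\tilde{\bm w}_i\in\mathbb{R}^{N_i}$. - $Q_i$ is the diagonal matrix with diagonal $(\tfrac{\rho}{2},\dots,\tfrac{\rho}{2},\hat c_i)$ ($2N_i$ entries equal to $\rho/2$, then $\hat c_i$), with $\rho>0$ and $\hat c_i>0$. - $\bm q_i=[(q_i^{tx}-q_i^{proc})\bm 1,\ (q_i^{rx}+q_i^{proc})\bm 1,\ 0]\in\mathbb{R}^{2N_i+1}$, where $\bm 1\in\mathbb{R}^{N_i}$ is the all-ones vector and $q_i^{tx},q_i^{rx},q_i^{proc}$ are the positive unit transmission, reception and processing costs (so $\bm q_i\neq\bm 0$). - $\hat P_i^{H}\in\mathbb{R}$ is a given number (residual renewable power, possibly negative). - $\bm\nu_i$ is a given real vector of Lagrange multipliers and $A_i$ a given real matrix of compatible size with $2N_i+1$ columns. In the application, these are such that $\bm\nu_i^T A_i\bm x_i=\lambda_i\big[\bm 1^T(\tilde{\bm o}_i-\bm o_i)-\hat\delta_i\big]-\bm\gamma_i^T\bm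 o_i-\tilde{\bm\gamma}_i^T\tilde{\bm o}_i+\bm\mu_i^T\bm o_i-\tilde{\bm\mu}_i^T\tilde{\bm o}_i-\hat\varphi_i\hat\delta_i$ for given multipliers $\lambda_i,\hat\varphi_i\in\mathbb{R}$ and $\bm\gamma_i,\tilde{\bm\gamma}_i,\bm\mu_i,\tilde{\bm\mu}_i\in\mathbb{R}^{N_i}$. The "primal step" of the dual ascent algorithm is the minimization of $\mathcal{L}_i$ over $\bm x_i$ with the multipliers fixed. *)

theory Defs
  imports Jordan_Normal_Form.Matrix
begin

text \<open>
  Vectors of \<open>\<real>\<^sup>d\<close> are the elements of \<open>carrier_vec d\<close>, so that the dimension \<open>2 * N i + 1\<close> may
  differ from node to node.  A local variable is the concatenation \<open>[o, o', \<delta>]\<close> of two blocks of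
  length \<open>n\<close> (workload sent, workload received) and one scalar slack, where \<open>n\<close> is the number of
  neighbours; \<open>\<nu> \<bullet> (A *\<^sub>v x)\<close> is \<open>\<nu>\<^sup>T A x\<close>.
\<close>

definition center_vec :: "real vec \<Rightarrow> real vec \<Rightarrow> real vec" where
  "center_vec w w' = w @\<^sub>v w' @\<^sub>v 0\<^sub>v 1"

definition weight_mat :: "nat \<Rightarrow> real \<Rightarrow> real \<Rightarrow> real mat" where
  "weight_mat n \<rho> c = mat_diag (2 * n + 1) (\<lambda>k. if k < 2 * n then \<rho> / 2 else c)"

definition cost_vec :: "nat \<Rightarrow> real \<Rightarrow> real \<Rightarrow> real \<Rightarrow> real vec" where
  "cost_vec n q_tx q_rx q_proc =
     vec n (\<lambda>_. q_tx - q_proc) @\<^sub>v vec n (\<lambda>_. q_rx + q_proc) @\<^sub>v 0\<^sub>v 1"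

definition smooth_part :: "real vec \<Rightarrow> real mat \<Rightarrow> real vec \<Rightarrow> real mat \<Rightarrow> real vec \<Rightarrow> real" where
  "smooth_part b Q \<nu> A x = (x - b) \<bullet> (Q *\<^sub>v (x - b)) + \<nu> \<bullet> (A *\<^sub>v x)"

definition excess :: "real vec \<Rightarrow> real \<Rightarrow> real vec \<Rightarrow> real" where
  "excess q P x = q \<bullet> x - P"

end

theory Submission
  imports Defs
begin

text \<open>
  For a multiplier \<open>t\<close> the penalized objective \<open>u + t h\<close> is a strictly convex diagonal quadratic with
  minimizer \<open>z t\<close> in closed form, and \<open>h (z t)\<close> is affine and strictly decreasing in \<open>t\<close>.  Since
  \<open>max (h x) 0 \<ge> t * h x\<close> for \<open>0 \<le> t \<le> 1\<close>, the point \<open>z t\<close> minimizes \<open>u + max h 0\<close> as soon as equality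
  holds at \<open>z t\<close>; this is achieved with \<open>t = 0\<close> if \<open>h (z 0) \<le> 0\<close>, with \<open>t = 1\<close> if \<open>h (z 1) > 0\<close>, and
  otherwise with the \<open>t\<close> for which \<open>h (z t) = 0\<close>.
\<close>

lemma strict_minimizer_is_arg_min:
  fixes f :: "'a \<Rightarrow> 'b::linorder"
  assumes "Q a" and "\<And>x. Q x \<Longrightarrow> x \<noteq> a \<Longrightarrow> f a < f x"
  shows "is_arg_min f Q x \<longleftrightarrow> x = a"
  using assms unfolding is_arg_min_def by (metis order_less_asym order_less_irrefl)

text \<open>\<open>arg_min\<close> is a choice operator, so its value is known only where the
  minimizer is unique. A strict inequality against every other admissible point supplies uniqueness
  and the value together.\<close>

lemma strict_minimizer_unique:
  fixes f :: "'a \<Rightarrow> 'b::linorder"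
  assumes "Q a" and "\<And>x. Q x \<Longrightarrow> x \<noteq> a \<Longrightarrow> f a < f x"
  shows "\<exists>!x. is_arg_min f Q x" and "arg_min f Q = a"
proof -
  have "is_arg_min f Q = (\<lambda>x. x = a)"
    using strict_minimizer_is_arg_min[of Q a f, OF assms] by blast
  then show "\<exists>!x. is_arg_min f Q x" and "arg_min f Q = a"
    by (simp_all add: arg_min_def)
qed

text \<open>The case distinction, separated from vectors: \<open>z\<close> is the curve of penalized
  minimizers. The assumptions range over all real \<open>t\<close>, since the root of
  \<open>h (z t)\<close> may fall outside [0,1] and still has to provide the constrained minimizer
  \<open>x_eq\<close>.\<close>

lemma positive_part_min_cases:
  fixes u h :: "'a \<Rightarrow> real" and z :: "real \<Rightarrow> 'a" and \<kappa> :: real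
  assumes z: "\<And>t. z t \<in> X"
    and min: "\<And>t x. x \<in> X \<Longrightarrow> x \<noteq> z t \<Longrightarrow> u (z t) + t * h (z t) < u x + t * h x"
    and h: "\<And>t. h (z t) = h (z 0) - t * \<kappa>"
    and \<kappa>: "\<kappa> > 0"
  defines "L \<equiv> \<lambda>x. u x + max (h x) 0"
    and "x_u \<equiv> arg_min u (\<lambda>x. x \<in> X)"
    and "x_uh \<equiv> arg_min (\<lambda>x. u x + h x) (\<lambda>x. x \<in> X)"
    and "x_eq \<equiv> arg_min u (\<lambda>x. x \<in> X \<and> h x = 0)"
  shows "(\<exists>!x. is_arg_min L (\<lambda>x. x \<in> X) x)
    \<and> (\<exists>!x. is_arg_min u (\<lambda>x. x \<in> X) x)
    \<and> (\<exists>!x. is_arg_min (\<lambda>x. u x + h x) (\<lambda>x. x \<in> X) x)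
    \<and> (\<exists>!x. is_arg_min u (\<lambda>x. x \<in> X \<and> h x = 0) x)
    \<and> \<not> (h x_u \<le> 0 \<and> h x_uh > 0)
    \<and> (h x_u \<le> 0 \<longrightarrow> arg_min L (\<lambda>x. x \<in> X) = x_u)
    \<and> (h x_uh > 0 \<longrightarrow> arg_min L (\<lambda>x. x \<in> X) = x_uh)
    \<and> (\<not> h x_u \<le> 0 \<and> \<not> h x_uh > 0 \<longrightarrow> arg_min L (\<lambda>x. x \<in> X) = x_eq)"
proof -
  \<comment> \<open>The unique zero of the affine function
    \<open>h (z t) = h (z 0) - t * \<kappa>\<close>.\<close>
  define s where "s = h (z 0) / \<kappa>"
  have hs: "h (z s) = 0"
    using h[of s] \<kappa> by (simp add: s_def)
  have u: "\<exists>!x. is_arg_min u (\<lambda>x. x \<in> X) x" "x_u = z 0"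
    unfolding x_u_def using strict_minimizer_unique[of "\<lambda>x. x \<in> X" "z 0" u] z min[of _ 0] by simp_all
  have uh: "\<exists>!x. is_arg_min (\<lambda>x. u x + h x) (\<lambda>x. x \<in> X) x" "x_uh = z 1"
    unfolding x_uh_def using strict_minimizer_unique[of "\<lambda>x. x \<in> X" "z 1" "\<lambda>x. u x + h x"] z min[of _ 1]
    by simp_all
  \<comment> \<open>The penalty \<open>s * h\<close> vanishes both at \<open>z s\<close> and on the
    constraint set, so minimality for \<open>u + s h\<close> becomes minimality for \<open>u\<close>
    there, whatever the sign of \<open>s\<close>.\<close>
  have "u (z s) < u x" if "x \<in> X \<and> h x = 0" "x \<noteq> z s" for x
    using min[of x s] that hs by simp
  then have eq: "\<exists>!x. is_arg_min u (\<lambda>x. x \<in> X \<and> h x = 0) x" "x_eq = z s"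
    unfolding x_eq_def using strict_minimizer_unique[of "\<lambda>x. x \<in> X \<and> h x = 0" "z s" u] z hs by simp_all
  \<comment> \<open>The chain is
    \<open>L x \<ge> u x + t * h x > u (z t) + t * h (z t) = L (z t)\<close>; \<open>tight\<close>
    is the last equality, a complementarity condition on \<open>t\<close>.\<close>
  have L: "(\<exists>!x. is_arg_min L (\<lambda>x. x \<in> X) x) \<and> arg_min L (\<lambda>x. x \<in> X) = z t"
    if t: "0 \<le> t" "t \<le> 1" and tight: "max (h (z t)) 0 = t * h (z t)" for t
  proof -
    have "L (z t) < L x" if "x \<in> X" "x \<noteq> z t" for x
    proof -
      have "t * h x \<le> max (h x) 0"
      proof (cases "h x \<ge> 0")
        case True
        then show ?thesis
          using mult_right_mono[OF t(2) True] by simp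
      next
        case False
        then show ?thesis
          using t(1) by (simp add: mult_nonneg_nonpos max_def)
      qed
      with min[OF that] tight show ?thesis
        by (simp add: L_def)
    qed
    then show ?thesis
      using strict_minimizer_unique[of "\<lambda>x. x \<in> X" "z t" L] z by blast
  qed
  \<comment> \<open>Going from \<open>t = 0\<close> to \<open>t = 1\<close> lowers
    \<open>h (z t)\<close> by \<open>\<kappa> > 0\<close>.\<close>
  have disj: "\<not> (h (z 0) \<le> 0 \<and> h (z 1) > 0)"
    using h[of 1] \<kappa> by simp
  consider "h (z 0) \<le> 0" | "h (z 1) > 0" | "h (z 0) > 0" "h (z 1) \<le> 0"
    by linarith
  then show ?thesis
  proof cases
    case 1
    then show ?thesis
      using L[of 0] u uh eq disj by simp
  next
    case 2
    then show ?thesis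
      using L[of 1] u uh eq disj by simp
  next
    case 3
    \<comment> \<open>The affine function \<open>h (z t)\<close> is positive at 0 and nonpositive at
      1, so its zero lies in between.\<close>
    then have "0 \<le> s" "s \<le> 1"
      using h[of 1] \<kappa> by (simp_all add: s_def)
    then show ?thesis
      using L[of s] u uh eq hs 3 by simp
  qed
qed

lemma mat_diag_quadratic_form:
  fixes y :: "'a::comm_semiring_1 vec"
  assumes "y \<in> carrier_vec d"
  shows "y \<bullet> (mat_diag d D *\<^sub>v y) = (\<Sum>k<d. D k * (y $ k)\<^sup>2)"
proof -
  have "(mat_diag d D *\<^sub>v y) $ k = D k * y $ k" if "k < d" for k
  proof -
    have "(mat_diag d D *\<^sub>v y) $ k = (\<Sum>j = 0..<d. (if k = j then D j else 0) * y $ j)"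
      using assms that by (simp add: mat_diag_def scalar_prod_def)
    also have "\<dots> = (\<Sum>j = 0..<d. if k = j then D j * y $ j else 0)"
      by (rule sum.cong) simp_all
    finally show ?thesis
      using that by simp
  qed
  then show ?thesis
    by (simp add: scalar_prod_def mat_diag_def power2_eq_square ac_simps lessThan_atLeast0)
qed

text \<open>Moving \<open>A\<close> onto the multipliers turns the linear term into a coordinatewise
  sum, so the objective separates into scalar quadratics.\<close>

lemma smooth_part_mat_diag:
  assumes "b \<in> carrier_vec d" "x \<in> carrier_vec d" "\<nu> \<in> carrier_vec m" "A \<in> carrier_mat m d"
  shows "smooth_part b (mat_diag d D) \<nu> A x =
    (\<Sum>k<d. D k * (x $ k - b $ k)\<^sup>2 + (A\<^sup>T *\<^sub>v \<nu>) $ k * x $ k)"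
proof -
  have "\<nu> \<bullet> (A *\<^sub>v x) = (A\<^sup>T *\<^sub>v \<nu>) \<bullet> x"
    using assms by (simp add: transpose_vec_mult_scalar)
  also have "\<dots> = (\<Sum>k<d. (A\<^sup>T *\<^sub>v \<nu>) $ k * x $ k)"
    using assms by (simp add: scalar_prod_def lessThan_atLeast0 del: index_mult_mat_vec)
  finally show ?thesis
    using assms by (simp add: smooth_part_def mat_diag_quadratic_form sum.distrib del: index_mult_mat_vec)
qed

lemma excess_sum:
  assumes "x \<in> carrier_vec d"
  shows "excess q P x = (\<Sum>k<d. q $ k * x $ k) - P"
  using assms by (simp add: excess_def scalar_prod_def lessThan_atLeast0)

text \<open>\<open>z t\<close> solves the stationarity equations \<open>2 * D k * (x $ k - b $ k) +
  (A\<^sup>T *\<^sub>v \<nu>) $ k + t * q $ k = 0\<close>. Substituting it into the affine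
  \<open>h\<close> gives the slope in \<open>t\<close>.\<close>

lemma diagonal_quadratic_minimizer:
  fixes D :: "nat \<Rightarrow> real" and q :: "real vec" and P :: real
  assumes b: "b \<in> carrier_vec d" and \<nu>: "\<nu> \<in> carrier_vec m" and A: "A \<in> carrier_mat m d"
    and D: "\<And>k. k < d \<Longrightarrow> D k > 0"
  defines "u \<equiv> smooth_part b (mat_diag d D) \<nu> A"
    and "h \<equiv> excess q P"
    and "z \<equiv> \<lambda>t. vec d (\<lambda>k. b $ k - ((A\<^sup>T *\<^sub>v \<nu>) $ k + t * q $ k) / (2 * D k))"
  shows "x \<in> carrier_vec d \<Longrightarrow> x \<noteq> z t \<Longrightarrow> u (z t) + t * h (z t) < u x + t * h x"
    and "h (z t) = h (z 0) - t * (\<Sum>k<d. (q $ k)\<^sup>2 / (2 * D k))"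
proof -
  define p where "p = A\<^sup>T *\<^sub>v \<nu>"
  have z: "z t \<in> carrier_vec d" for t
    by (simp add: z_def)
  have z_nth: "z t $ k = b $ k - (p $ k + t * q $ k) / (2 * D k)" if "k < d" for t k
    using that by (simp add: z_def p_def)
  have u: "u x = (\<Sum>k<d. D k * (x $ k - b $ k)\<^sup>2 + p $ k * x $ k)" if "x \<in> carrier_vec d" for x
    unfolding u_def p_def by (rule smooth_part_mat_diag[OF b that \<nu> A])
  have h: "h x = (\<Sum>k<d. q $ k * x $ k) - P" if "x \<in> carrier_vec d" for x
    unfolding h_def by (rule excess_sum[OF that])
  show "u (z t) + t * h (z t) < u x + t * h x" if x: "x \<in> carrier_vec d" and ne: "x \<noteq> z t"
  proof -
    \<comment> \<open>Expanding around the stationary point \<open>z t\<close> cancels all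
      first-order terms, so the gap is exactly the weighted square distance to
      \<open>z t\<close>.\<close>
    have "(u x + t * h x) - (u (z t) + t * h (z t)) =
        (\<Sum>k<d. (D k * (x $ k - b $ k)\<^sup>2 + p $ k * x $ k + t * (q $ k * x $ k))
          - (D k * (z t $ k - b $ k)\<^sup>2 + p $ k * z t $ k + t * (q $ k * z t $ k)))"
      by (simp add: u[OF x] h[OF x] u[OF z] h[OF z] right_diff_distrib sum.distrib sum_subtractf
          sum_distrib_left)
    also have "\<dots> = (\<Sum>k<d. D k * (x $ k - z t $ k)\<^sup>2)"
    proof (rule sum.cong)
      fix k assume "k \<in> {..<d}"
      then have "k < d" by simp
      have "p $ k + t * q $ k = 2 * D k * (b $ k - z t $ k)"
        using D[OF \<open>k < d\<close>] by (simp add: z_nth[OF \<open>k < d\<close>])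
      \<comment> \<open>Stationarity solved for \<open>p $ k\<close>: eliminating it leaves a
        polynomial identity without division.\<close>
      then have "p $ k = 2 * D k * (b $ k - z t $ k) - t * q $ k"
        by simp
      then show "(D k * (x $ k - b $ k)\<^sup>2 + p $ k * x $ k + t * (q $ k * x $ k))
          - (D k * (z t $ k - b $ k)\<^sup>2 + p $ k * z t $ k + t * (q $ k * z t $ k))
          = D k * (x $ k - z t $ k)\<^sup>2"
        by (simp only:) (simp add: power2_eq_square algebra_simps)
    qed simp
    also have "\<dots> > 0"
    proof -
      \<comment> \<open>Distinct vectors of equal dimension differ in some coordinate, whose term
        makes the sum positive.\<close>
      obtain k where k: "k < d" "x $ k \<noteq> z t $ k"
        using x z[of t] ne by (metis carrier_vecD eq_vecI)
      show ?thesis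
        by (rule sum_pos2[of _ k]) (use k D in \<open>auto intro!: mult_nonneg_nonneg less_imp_le[OF D]\<close>)
    qed
    finally show ?thesis
      by simp
  qed
  show "h (z t) = h (z 0) - t * (\<Sum>k<d. (q $ k)\<^sup>2 / (2 * D k))"
    by (simp add: h[OF z] z_nth sum_distrib_left diff_divide_distrib add_divide_distrib
        power2_eq_square algebra_simps flip: sum_subtractf sum.distrib)
qed

theorem proposition1:
  fixes nodes :: "'i set"
    and N m :: "'i \<Rightarrow> nat"
    and w w' \<nu> :: "'i \<Rightarrow> real vec"
    and A :: "'i \<Rightarrow> real mat"
    and \<rho> :: real
    and c q_tx q_rx q_proc P :: "'i \<Rightarrow> real"
    and u h L :: "'i \<Rightarrow> real vec \<Rightarrow> real"
    and X :: "'i \<Rightarrow> real vec set"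
    and x_plus x_u x_uh x_eq :: "'i \<Rightarrow> real vec"
  assumes "finite nodes"
    and "\<And>i. i \<in> nodes \<Longrightarrow> N i \<ge> 1"
    and "\<And>i. i \<in> nodes \<Longrightarrow> w i \<in> carrier_vec (N i)"
    and "\<And>i. i \<in> nodes \<Longrightarrow> w' i \<in> carrier_vec (N i)"
    and "\<And>i. i \<in> nodes \<Longrightarrow> \<nu> i \<in> carrier_vec (m i)"
    and "\<And>i. i \<in> nodes \<Longrightarrow> A i \<in> carrier_mat (m i) (2 * N i + 1)"
    and "\<rho> > 0"
    and "\<And>i. i \<in> nodes \<Longrightarrow> c i > 0"
    and "\<And>i. i \<in> nodes \<Longrightarrow> q_tx i > 0"
    and "\<And>i. i \<in> nodes \<Longrightarrow> q_rx i > 0"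
    and "\<And>i. i \<in> nodes \<Longrightarrow> q_proc i > 0"
  defines "u \<equiv> \<lambda>i. smooth_part (center_vec (w i) (w' i)) (weight_mat (N i) \<rho> (c i)) (\<nu> i) (A i)"
    and "h \<equiv> \<lambda>i. excess (cost_vec (N i) (q_tx i) (q_rx i) (q_proc i)) (P i)"
    and "L \<equiv> \<lambda>i x. u i x + max (h i x) 0"
    and "X \<equiv> \<lambda>i. carrier_vec (2 * N i + 1)"
    and "x_plus \<equiv> \<lambda>i. arg_min (L i) (\<lambda>x. x \<in> X i)"
    and "x_u \<equiv> \<lambda>i. arg_min (u i) (\<lambda>x. x \<in> X i)"
    and "x_uh \<equiv> \<lambda>i. arg_min (\<lambda>x. u i x + h i x) (\<lambda>x. x \<in> X i)"
    and "x_eq \<equiv> \<lambda>i. arg_min (u i) (\<lambda>x. x \<in> X i \<and> h i x = 0)"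
  shows "\<forall>i\<in>nodes.
      (\<exists>!x. is_arg_min (L i) (\<lambda>x. x \<in> X i) x)
    \<and> (\<exists>!x. is_arg_min (u i) (\<lambda>x. x \<in> X i) x)
    \<and> (\<exists>!x. is_arg_min (\<lambda>x. u i x + h i x) (\<lambda>x. x \<in> X i) x)
    \<and> (\<exists>!x. is_arg_min (u i) (\<lambda>x. x \<in> X i \<and> h i x = 0) x)
    \<and> \<not> (h i (x_u i) \<le> 0 \<and> h i (x_uh i) > 0)
    \<and> (h i (x_u i) \<le> 0 \<longrightarrow> x_plus i = x_u i)
    \<and> (h i (x_uh i) > 0 \<longrightarrow> x_plus i = x_uh i)
    \<and> (\<not> h i (x_u i) \<le> 0 \<and> \<not> h i (x_uh i) > 0 \<longrightarrow> x_plus i = x_eq i)"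
proof
  fix i assume i: "i \<in> nodes"
  define d where "d = 2 * N i + 1"
  define D where "D = (\<lambda>k. if k < 2 * N i then \<rho> / 2 else c i)"
  define b where "b = center_vec (w i) (w' i)"
  define q where "q = cost_vec (N i) (q_tx i) (q_rx i) (q_proc i)"
  define z where "z = (\<lambda>t. vec d (\<lambda>k. b $ k - (((A i)\<^sup>T *\<^sub>v \<nu> i) $ k + t * q $ k) / (2 * D k)))"
  define \<kappa> where "\<kappa> = (\<Sum>k<d. (q $ k)\<^sup>2 / (2 * D k))"
  have b: "b \<in> carrier_vec d"
    using assms(3,4)[OF i] unfolding b_def center_vec_def d_def carrier_vec_def by simp
  have \<nu>: "\<nu> i \<in> carrier_vec (m i)"
    by (rule assms(5)[OF i])
  have A: "A i \<in> carrier_mat (m i) d"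
    using assms(6)[OF i] by (simp add: d_def)
  have D: "D k > 0" for k
    using assms(7) assms(8)[OF i] by (simp add: D_def)
  have u: "u i = smooth_part b (mat_diag d D) (\<nu> i) (A i)"
    by (simp add: u_def b_def weight_mat_def d_def D_def)
  have h: "h i = excess q (P i)"
    by (simp add: h_def q_def)
  have X: "X i = carrier_vec d"
    by (simp add: X_def d_def)
  \<comment> \<open>Index \<open>N i\<close> is the first entry of the received-workload block,
    present because \<open>N i \<ge> 1\<close>. Its cost is a sum of positive numbers, whereas
    \<open>q_tx i - q_proc i\<close> in the first block may be zero; hence
    \<open>\<kappa> > 0\<close>.\<close>
  have "N i < d" "q $ N i = q_rx i + q_proc i"
    using assms(2)[OF i] by (simp_all add: q_def cost_vec_def d_def)
  then have "\<kappa> > 0"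
    unfolding \<kappa>_def using D assms(10,11)[OF i]
    by (intro sum_pos2[of _ "N i"]) (auto intro!: divide_nonneg_pos)
  then show "(\<exists>!x. is_arg_min (L i) (\<lambda>x. x \<in> X i) x)
    \<and> (\<exists>!x. is_arg_min (u i) (\<lambda>x. x \<in> X i) x)
    \<and> (\<exists>!x. is_arg_min (\<lambda>x. u i x + h i x) (\<lambda>x. x \<in> X i) x)
    \<and> (\<exists>!x. is_arg_min (u i) (\<lambda>x. x \<in> X i \<and> h i x = 0) x)
    \<and> \<not> (h i (x_u i) \<le> 0 \<and> h i (x_uh i) > 0)
    \<and> (h i (x_u i) \<le> 0 \<longrightarrow> x_plus i = x_u i)
    \<and> (h i (x_uh i) > 0 \<longrightarrow> x_plus i = x_uh i)
    \<and> (\<not> h i (x_u i) \<le> 0 \<and> \<not> h i (x_uh i) > 0 \<longrightarrow> x_plus i = x_eq i)"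
    unfolding L_def x_plus_def x_u_def x_uh_def x_eq_def u h X
    using diagonal_quadratic_minimizer[where D = D, OF b \<nu> A D, where q = q and P = "P i"]
    by (intro positive_part_min_cases[where z = z and \<kappa> = \<kappa>]) (simp_all add: z_def \<kappa>_def)
qed

end
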